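(* Let $f(q)=\sum_{m=0}^n q^m a_m$, $a_m\in\mathbb H$, be a non-constant slice-regular polynomial, and set $S_f:=\mathrm{span}_{\mathbb R}\{a_1,\dots,a_n\}\subset\mathbb H$. The following conditions are equivalent: (1) the twistor transform $G_f$ is planar; (2) there exists a non-zero $\mathbb R$-linear map $\Lambda:\mathbb H\to\mathbb C$ such that $\Lambda(a_m)=0$ for all $m=1,\dots,n$; (3) the non-constant coefficients of $f$ are contained in a proper real linear subspace of $\mathbb H$, that is, $\dim_{\mathbb R}S_f\le 3$.
   Context: $\mathbb H$ denotes the quaternions and $\mathbb S=\{q\in\mathbb H: q^2=-1\}$. Fix $i,j\in\mathbb S$ with $ij=-ji$, and put $\mathbb C:=\mathbb R+\mathbb R i\subset\mathbb H$, $\mathbb C^+:=\{x+yi:y>0\}$. Every quaternion is uniquely $z+wj$ with $z,w\in\mathbb C$. Let $\Omega\subset\mathbb H$ be a symmetric slice domain: a domain with $\Omega\cap\mathbb R\ne\emptyset$, with $\Omega\cap(\mathbb R+\mathbb R I)$ a domain for all $I\in\mathbb S$, and such that $x+yI\in\Omega$ implies $x+yI'\in\Omega$ for all $I,I'\in\mathbb S$ ($x,y\in\mathbb R$). Put $V:=\Omega\cap\mathbb C^+$. Polynomials $\sum q^ma_m$ are regarded as (slice-regular) functions on $\Omega$. For $f(q)=\sum_{m=0}^n q^ma_m$ write $f(z)=g(z)+h(z)j$ for $z\in\Omega\cap\mathbb C$, with $g,h$ holomorphic and $\mathbb C$-valued, and set $\hat g(z)=\overline{g(\overline z)}$, $\hat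 h(z)=\overline{h(\overline z)}$. The twistor transform of $f$ is the holomorphic curve $G_f:V\to\mathrm{Gr}_2(\mathbb C^4)\subset\mathbb P(\Lambda^2\mathbb C^4)\cong\mathbb{CP}^5$ given in homogeneous coordinates by $$G_f(v)=[g(v)\hat g(v)+h(v)\hat h(v):h(v):-g(v):\hat g(v):\hat h(v):1].$$ Here homogeneous coordinates $[\zeta_1:\dots:\zeta_6]$ are with respect to the basis $e_3\wedge e_4,\,-e_2\wedge e_4,\,e_2\wedge e_3,\,e_1\wedge e_4,\,-e_1\wedge e_3,\,e_1\wedge e_2$, and $\mathrm{Gr}_2(\mathbb C^4)$ is the quadric $\zeta_1\zeta_6-\zeta_2\zeta_5+\zeta_3\zeta_4=0$. A holomorphic curve $G:V\to\mathrm{Gr}_2(\mathbb C^4)$ is planar if there is a non-zero $z=(z_1,\dots,z_6)\in\mathbb C^6$ with $G(V)\subset X_z:=\mathrm{Gr}_2(\mathbb C^4)\cap\{[\zeta]: z_1\zeta_1+\dots+z_6\zeta_6=0\}$. *)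

theory Defs
  imports "HOL-Analysis.Analysis"
begin

section \<open>The quaternions\<close>

datatype quat = Quat (Qre: real) (Qi: real) (Qj: real) (Qk: real)

lemma quat_eq_iff:
  "p = q \<longleftrightarrow> Qre p = Qre q \<and> Qi p = Qi q \<and> Qj p = Qj q \<and> Qk p = Qk q"
  by (cases p; cases q) simp

instantiation quat :: ring_1
begin

definition "0 = Quat 0 0 0 0"
definition "1 = Quat 1 0 0 0"
definition "p + q = Quat (Qre p + Qre q) (Qi p + Qi q) (Qj p + Qj q) (Qk p + Qk q)"
definition "- p = Quat (- Qre p) (- Qi p) (- Qj p) (- Qk p)"
definition "p - q = Quat (Qre p - Qre q) (Qi p - Qi q) (Qj p - Qj q) (Qk p - Qk q)"
definition "p * q =
  Quat (Qre p * Qre q - Qi p * Qi q - Qj p * Qj q - Qk p * Qk q)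
       (Qre p * Qi q + Qi p * Qre q + Qj p * Qk q - Qk p * Qj q)
       (Qre p * Qj q - Qi p * Qk q + Qj p * Qre q + Qk p * Qi q)
       (Qre p * Qk q + Qi p * Qj q - Qj p * Qi q + Qk p * Qre q)"

instance
  by standard
    (simp_all add: quat_eq_iff zero_quat_def one_quat_def plus_quat_def uminus_quat_def
      minus_quat_def times_quat_def algebra_simps)

end

instantiation quat :: real_algebra_1
begin

definition "r *\<^sub>R q = Quat (r * Qre q) (r * Qi q) (r * Qj q) (r * Qk q)"

instance
  by standard
    (simp_all add: quat_eq_iff plus_quat_def one_quat_def times_quat_def scaleR_quat_def
      algebra_simps)

end

instantiation quat :: real_inner
begin

definition "inner p q = Qre p * Qre q + Qi p * Qi q + Qj p * Qj q + Qk p * Qk q"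
definition norm_quat where "norm_quat q = sqrt (inner q q)" for q :: quat
definition sgn_quat where "sgn_quat q = q /\<^sub>R norm q" for q :: quat
definition dist_quat where "dist_quat p q = norm (p - q)" for p q :: quat
definition uniformity_quat :: "(quat \<times> quat) filter" where
  "uniformity_quat = (INF e\<in>{0<..}. principal {(p, q). dist p q < e})"
definition open_quat :: "quat set \<Rightarrow> bool" where
  "open_quat U \<longleftrightarrow> (\<forall>p\<in>U. eventually (\<lambda>(p', q). p' = p \<longrightarrow> q \<in> U) uniformity)"

instance
proof
  fix p q s :: quat and r :: real
  show "inner p q = inner q p" "inner (r *\<^sub>R p) q = r * inner p q"
    "inner (p + q) s = inner p s + inner q s"
    by (simp_all add: inner_quat_def scaleR_quat_def plus_quat_def algebra_simps)
  show "0 \<le> inner p p"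
    unfolding inner_quat_def by (intro add_nonneg_nonneg zero_le_square)
  show "inner p p = 0 \<longleftrightarrow> p = 0"
    unfolding inner_quat_def zero_quat_def quat_eq_iff quat.sel
    by (simp only: add_nonneg_eq_0_iff add_nonneg_nonneg zero_le_square mult_eq_0_iff) simp
qed (fact norm_quat_def sgn_quat_def dist_quat_def uniformity_quat_def open_quat_def)+

end

instantiation quat :: euclidean_space
begin

definition "Basis = {Quat 1 0 0 0, Quat 0 1 0 0, Quat 0 0 1 0, Quat 0 0 0 1}"

instance
proof
  show "(Basis :: quat set) \<noteq> {}" "finite (Basis :: quat set)"
    by (simp_all add: Basis_quat_def)
  show "inner u v = (if u = v then 1 else 0)" if "u \<in> Basis" "v \<in> Basis" for u v :: quat
    using that unfolding Basis_quat_def by (elim insertE emptyE) (simp_all add: inner_quat_def)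
  show "(\<forall>u\<in>Basis. inner q u = 0) \<longleftrightarrow> q = 0" for q :: quat
    by (cases q) (simp add: Basis_quat_def inner_quat_def zero_quat_def)
qed

end

lemma DIM_quat [simp]: "DIM(quat) = 4"
  by (simp add: Basis_quat_def)

section \<open>Slices and symmetric slice domains\<close>

definition imag_units :: "quat set" where
  "imag_units = {q. q\<^sup>2 = -1}"

text \<open>For an imaginary unit \<open>I\<close>, this is the embedding \<open>x + y\<i> \<mapsto> x + y I\<close> of the complex numbers
  with image the slice \<open>\<real> + \<real> I\<close>. For the fixed unit \<open>i\<close> it realises the identification of the
  complex numbers with a subset of the quaternions.\<close>

definition slice_embed :: "quat \<Rightarrow> complex \<Rightarrow> quat" where
  "slice_embed I z = of_real (Re z) + of_real (Im z) * I"

definition slice :: "quat \<Rightarrow> quat set" where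
  "slice I = range (slice_embed I)"

definition symmetric_slice_domain :: "quat set \<Rightarrow> bool" where
  "symmetric_slice_domain \<Omega> \<longleftrightarrow>
     open \<Omega> \<and> connected \<Omega> \<and> \<Omega> \<inter> \<real> \<noteq> {} \<and>
     (\<forall>I\<in>imag_units. openin (top_of_set (slice I)) (\<Omega> \<inter> slice I) \<and>
        connected (\<Omega> \<inter> slice I) \<and> \<Omega> \<inter> slice I \<noteq> {}) \<and>
     (\<forall>I\<in>imag_units. \<forall>I'\<in>imag_units. \<forall>x y :: real.
        of_real x + of_real y * I \<in> \<Omega> \<longrightarrow> of_real x + of_real y * I' \<in> \<Omega>)"

definition upper_half_slice :: "quat \<Rightarrow> quat set \<Rightarrow> complex set" where
  "upper_half_slice i \<Omega> = {z. Im z > 0 \<and> slice_embed i z \<in> \<Omega>}"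

section \<open>The splitting \<open>q = z + w j\<close>\<close>

definition split_fst :: "quat \<Rightarrow> quat \<Rightarrow> quat \<Rightarrow> complex" where
  "split_fst i j q = (THE z. \<exists>w. q = slice_embed i z + slice_embed i w * j)"

definition split_snd :: "quat \<Rightarrow> quat \<Rightarrow> quat \<Rightarrow> complex" where
  "split_snd i j q = (THE w. \<exists>z. q = slice_embed i z + slice_embed i w * j)"

lemma imag_units_iff:
  "q \<in> imag_units \<longleftrightarrow> Qre q = 0 \<and> (Qi q)\<^sup>2 + (Qj q)\<^sup>2 + (Qk q)\<^sup>2 = 1"
proof
  assume "q \<in> imag_units"
  then have h: "Qre q * Qre q - Qi q * Qi q - Qj q * Qj q - Qk q * Qk q = -1"
    "Qre q * Qi q = 0" "Qre q * Qj q = 0" "Qre q * Qk q = 0"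
    by (auto simp: imag_units_def power2_eq_square times_quat_def one_quat_def uminus_quat_def
        mult.commute)
  have "Qre q = 0"
  proof (rule ccontr)
    assume "Qre q \<noteq> 0"
    with h have "Qre q * Qre q = -1" by simp
    then show False using zero_le_square[of "Qre q"] by linarith
  qed
  with h show "Qre q = 0 \<and> (Qi q)\<^sup>2 + (Qj q)\<^sup>2 + (Qk q)\<^sup>2 = 1"
    by (simp add: power2_eq_square)
next
  assume "Qre q = 0 \<and> (Qi q)\<^sup>2 + (Qj q)\<^sup>2 + (Qk q)\<^sup>2 = 1"
  then show "q \<in> imag_units"
    by (simp add: imag_units_def power2_eq_square times_quat_def one_quat_def uminus_quat_def)
qed

lemma of_real_quat: "of_real r = Quat r 0 0 0"
  by (simp add: of_real_def scaleR_quat_def one_quat_def)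

lemma norm_splitting:
  assumes "i \<in> imag_units" "j \<in> imag_units" "i * j = - (j * i)"
  shows "(norm (slice_embed i z + slice_embed i w * j))\<^sup>2 = (cmod z)\<^sup>2 + (cmod w)\<^sup>2"
proof -
  obtain b c d where i: "i = Quat 0 b c d" and i1: "b\<^sup>2 + c\<^sup>2 + d\<^sup>2 = 1"
    using assms(1) by (cases i) (auto simp: imag_units_iff)
  obtain p q r where j: "j = Quat 0 p q r" and j1: "p\<^sup>2 + q\<^sup>2 + r\<^sup>2 = 1"
    using assms(2) by (cases j) (auto simp: imag_units_iff)
  have o: "b * p + c * q + d * r = 0"
    using assms(3) by (simp add: i j times_quat_def uminus_quat_def)
  define k where "k = i * j"
  have k: "k = Quat 0 (c * r - d * q) (d * p - b * r) (b * q - c * p)"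
    using o by (simp add: k_def i j times_quat_def)
  have "(c * r - d * q)\<^sup>2 + (d * p - b * r)\<^sup>2 + (b * q - c * p)\<^sup>2
      = (b\<^sup>2 + c\<^sup>2 + d\<^sup>2) * (p\<^sup>2 + q\<^sup>2 + r\<^sup>2) - (b * p + c * q + d * r)\<^sup>2"
    by (simp add: power2_eq_square algebra_simps)
  then have kk: "inner k k = 1"
    using i1 j1 o by (simp add: inner_quat_def k power2_eq_square)
  have ii: "inner i i = 1" and jj: "inner j j = 1" and ij: "inner i j = 0"
    using i1 j1 o by (simp_all add: inner_quat_def i j power2_eq_square)
  have ik: "inner i k = 0" and jk: "inner j k = 0"
    by (simp_all add: inner_quat_def i j k algebra_simps)
  have oo: "inner (1::quat) 1 = 1" "inner 1 i = 0" "inner 1 j = 0" "inner 1 k = 0"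
    by (simp_all add: inner_quat_def one_quat_def i j k)
  have "slice_embed i z + slice_embed i w * j
      = Re z *\<^sub>R 1 + Im z *\<^sub>R i + Re w *\<^sub>R j + Im w *\<^sub>R k"
    by (simp add: slice_embed_def k_def of_real_def algebra_simps)
  moreover have "inner i 1 = 0" "inner j 1 = 0" "inner k 1 = 0" "inner j i = 0" "inner k i = 0"
    "inner k j = 0"
    using oo ij ik jk by (simp_all add: inner_commute)
  ultimately show ?thesis
    using oo ii jj kk ij ik jk
    by (simp only: power2_norm_eq_inner inner_add_left inner_add_right inner_scaleR_left
        inner_scaleR_right cmod_power2) (simp add: inner_complex_def power2_eq_square)
qed

lemma splitting_ex1:
  assumes "i \<in> imag_units" "j \<in> imag_units" "i * j = - (j * i)"
  shows "\<exists>!(z, w). q = slice_embed i z + slice_embed i w * j"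
proof -
  define T where "T = (\<lambda>(z, w). slice_embed i z + slice_embed i w * j)"
  have lin: "linear T"
    by (rule linearI)
      (auto simp: T_def slice_embed_def scaleR_conv_of_real[symmetric] algebra_simps
        split: prod.splits)
  have n: "(norm (T p))\<^sup>2 = (cmod (fst p))\<^sup>2 + (cmod (snd p))\<^sup>2" for p
    using norm_splitting[OF assms] by (simp add: T_def split: prod.splits)
  have inj: "inj T"
  proof (subst linear_injective_0[OF lin], intro allI impI)
    fix p assume "T p = 0"
    with n[of p] have "(cmod (fst p))\<^sup>2 + (cmod (snd p))\<^sup>2 = 0" by simp
    then show "p = 0" by (simp add: sum_power2_eq_zero_iff prod_eq_iff)
  qed
  have "dim (range T) = DIM(complex \<times> complex)"
    using dim_image_eq[OF lin, of UNIV] inj by simp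
  then have "dim (range T) = DIM(quat)" by simp
  then have "span (range T) = UNIV" by (simp only: dim_eq_full)
  moreover have "subspace (range T)"
    using linear_subspace_image[OF lin subspace_UNIV] .
  ultimately have "surj T" by (metis span_eq_iff)
  then have "\<exists>!p. q = T p" using inj by (metis surjD injD)
  then show ?thesis by (simp add: T_def case_prod_unfold)
qed

lemma split_fst_snd:
  assumes "i \<in> imag_units" "j \<in> imag_units" "i * j = - (j * i)"
  shows "split_fst i j (slice_embed i z + slice_embed i w * j) = z"
    and "split_snd i j (slice_embed i z + slice_embed i w * j) = w"
proof -
  let ?q = "slice_embed i z + slice_embed i w * j"
  have uniq: "p = (z, w)" if "?q = slice_embed i (fst p) + slice_embed i (snd p) * j" for p
  proof -
    have ex1: "\<exists>!p. ?q = slice_embed i (fst p) + slice_embed i (snd p) * j"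
      using splitting_ex1[OF assms, of ?q] unfolding case_prod_unfold .
    show ?thesis
      using ex1 that by (rule Uniq_D[OF ex1_iff_ex_Uniq[THEN iffD1, THEN conjunct2]]) simp
  qed
  have z: "z' = z" and w: "w' = w" if "?q = slice_embed i z' + slice_embed i w' * j" for z' w'
    using uniq[of "(z', w')"] that by simp_all
  show "split_fst i j ?q = z"
    unfolding split_fst_def
  proof (rule the_equality)
    show "\<exists>w'. ?q = slice_embed i z + slice_embed i w' * j" by (rule exI, rule refl)
  qed (elim exE, rule z)
  show "split_snd i j ?q = w"
    unfolding split_snd_def
  proof (rule the_equality)
    show "\<exists>z'. ?q = slice_embed i z' + slice_embed i w * j" by (rule exI, rule refl)
  qed (elim exE, rule w)
qed

section \<open>The Grassmannian and planar curves\<close>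

text \<open>A point of the five-dimensional complex projective space is the complex line spanned by its
  homogeneous coordinate vector. The coordinates \<open>[\<zeta>\<^sub>1 : \<dots> : \<zeta>\<^sub>6]\<close> of \<open>\<P>(\<Lambda>\<^sup>2 \<complex>\<^sup>4)\<close> refer to the basis
  \<open>e\<^sub>3 \<and> e\<^sub>4, - e\<^sub>2 \<and> e\<^sub>4, e\<^sub>2 \<and> e\<^sub>3, e\<^sub>1 \<and> e\<^sub>4, - e\<^sub>1 \<and> e\<^sub>3, e\<^sub>1 \<and> e\<^sub>2\<close>, in which the Pluecker image of the
  Grassmannian of 2-planes is the quadric below.\<close>

definition proj_point :: "complex ^ 6 \<Rightarrow> (complex ^ 6) set" where
  "proj_point \<zeta> = vec.span {\<zeta>}"

definition Gr2 :: "(complex ^ 6) set set" where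
  "Gr2 = {proj_point \<zeta> | \<zeta>. \<zeta> \<noteq> 0 \<and> \<zeta>$1 * \<zeta>$6 - \<zeta>$2 * \<zeta>$5 + \<zeta>$3 * \<zeta>$4 = 0}"

definition hyperplane_section :: "complex ^ 6 \<Rightarrow> (complex ^ 6) set set" where
  "hyperplane_section z = Gr2 \<inter> {proj_point \<zeta> | \<zeta>. \<zeta> \<noteq> 0 \<and> (\<Sum>k\<in>UNIV. z$k * \<zeta>$k) = 0}"

definition planar :: "complex set \<Rightarrow> (complex \<Rightarrow> (complex ^ 6) set) \<Rightarrow> bool" where
  "planar V G \<longleftrightarrow> (\<exists>z. z \<noteq> 0 \<and> G ` V \<subseteq> hyperplane_section z)"

section \<open>The twistor transform\<close>

definition twistor_transform :: "quat \<Rightarrow> quat \<Rightarrow> (quat \<Rightarrow> quat) \<Rightarrow> complex \<Rightarrow> (complex ^ 6) set" where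
  "twistor_transform i j f v =
     (let g = (\<lambda>z. split_fst i j (f (slice_embed i z)));
          h = (\<lambda>z. split_snd i j (f (slice_embed i z)));
          g' = (\<lambda>z. cnj (g (cnj z)));
          h' = (\<lambda>z. cnj (h (cnj z)))
      in proj_point (vector [g v * g' v + h v * h' v, h v, - g v, g' v, h' v, 1]))"

lemma vector_6 [simp]:
  "(vector [a, b, c, d, e, f] :: 'a::zero ^ 6) $ 1 = a"
  "(vector [a, b, c, d, e, f] :: 'a::zero ^ 6) $ 2 = b"
  "(vector [a, b, c, d, e, f] :: 'a::zero ^ 6) $ 3 = c"
  "(vector [a, b, c, d, e, f] :: 'a::zero ^ 6) $ 4 = d"
  "(vector [a, b, c, d, e, f] :: 'a::zero ^ 6) $ 5 = e"
  "(vector [a, b, c, d, e, f] :: 'a::zero ^ 6) $ 6 = f"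
  unfolding vector_def by simp_all

lemma twistor_transform_in_Gr2: "twistor_transform i j f v \<in> Gr2"
proof -
  have nz: "vector [a, b, c, d, e, 1] \<noteq> (0 :: complex ^ 6)" for a b c d e :: complex
    by (metis vector_6(6) zero_index zero_neq_one)
  show ?thesis
    unfolding twistor_transform_def Gr2_def Let_def
    by (rule CollectI, rule exI, rule conjI, rule refl, rule conjI[OF nz])
      (simp only: vector_6, simp add: algebra_simps)
qed

end

theory Submission
  imports Defs "HOL-Computational_Algebra.Polynomial"
begin

text \<open>
  Write \<open>a\<^sub>m = \<alpha>\<^sub>m + \<beta>\<^sub>m j\<close>. Powers of a point of the slice stay in the slice and multiply the
  coefficients from the left, so \<open>g\<close> and \<open>h\<close> are the complex polynomials with coefficients \<open>\<alpha>\<^sub>m\<close>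
  and \<open>\<beta>\<^sub>m\<close>, while the reflected functions have the conjugate coefficients. Planarity therefore
  means that for some \<open>c \<noteq> 0\<close> the polynomial
  \<open>c\<^sub>1 (g \<gamma> + h \<eta>) + c\<^sub>2 h - c\<^sub>3 g + c\<^sub>4 \<gamma> + c\<^sub>5 \<eta> + c\<^sub>6\<close>, where \<open>\<gamma>\<close> and \<open>\<eta>\<close> are the reflections
  of \<open>g\<close> and \<open>h\<close>, vanishes on the nonempty open set \<open>V\<close>, hence identically
  (\<open>planar_twistor_transform_iff\<close>).

  If \<open>d > 0\<close> is the larger of the degrees of \<open>g\<close> and \<open>h\<close>, the coefficient of degree \<open>2d\<close> of this
  polynomial is \<open>c\<^sub>1 (|\<alpha>\<^sub>d|\<^sup>2 + |\<beta>\<^sub>d|\<^sup>2)\<close>, because the other summands have degree at most \<open>d < 2d\<close>.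
  Thus \<open>c\<^sub>1 = 0\<close>: the quadratic term never takes part in a relation
  (\<open>quadratic_relation_imp_linear\<close>). What remains says, in each positive degree \<open>m\<close>, that the
  real-linear functional \<open>z + w j \<mapsto> c\<^sub>2 w - c\<^sub>3 z + c\<^sub>4 z\<^sup>* + c\<^sub>5 w\<^sup>*\<close> (a star denoting complex
  conjugation) kills \<open>a\<^sub>m\<close>, and in degree zero it determines \<open>c\<^sub>6\<close> as minus the value of the
  functional at \<open>a\<^sub>0\<close>. Every real-linear map from the quaternions to the complex numbers has this
  form for exactly one choice of \<open>c\<^sub>2, \<dots>, c\<^sub>5\<close> (\<open>coord_functional_representation\<close>,
  \<open>coord_functional_eq_0D\<close>), which gives the equivalence of planarity with the existence of \<open>\<Lambda>\<close>.

  The two remaining equivalences are linear algebra: the kernel of a nonzero \<open>\<Lambda>\<close> is a proper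
  subspace, a proper subspace is annihilated by the inner product with a vector orthogonal to it,
  and a subspace of the four-dimensional space of quaternions is proper iff its dimension is at
  most three.
\<close>

section \<open>Splitting of quaternionic polynomials on a slice\<close>

lemma slice_embed_0 [simp]: "slice_embed I 0 = 0"
  by (simp add: slice_embed_def)

lemma slice_embed_1 [simp]: "slice_embed I 1 = 1"
  by (simp add: slice_embed_def)

lemma slice_embed_add: "slice_embed I (z + w) = slice_embed I z + slice_embed I w"
  by (simp add: slice_embed_def algebra_simps)

lemma slice_embed_scaleR: "slice_embed I (r *\<^sub>R z) = r *\<^sub>R slice_embed I z"
  by (simp add: slice_embed_def scaleR_conv_of_real distrib_left mult.assoc)

lemma slice_embed_sum: "slice_embed I (sum F A) = (\<Sum>x\<in>A. slice_embed I (F x))"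
  by (induction A rule: infinite_finite_induct) (simp_all add: slice_embed_add)

lemma slice_embed_mult:
  assumes "I \<in> imag_units"
  shows "slice_embed I (z * w) = slice_embed I z * slice_embed I w"
proof -
  have "I * I = -1"
    using assms by (simp add: imag_units_def power2_eq_square)
  have "slice_embed I z * slice_embed I w
      = (Re z * Re w) *\<^sub>R 1 + (Re z * Im w + Im z * Re w) *\<^sub>R I + (Im z * Im w) *\<^sub>R (I * I)"
    by (simp add: slice_embed_def of_real_def algebra_simps)
  also have "\<dots> = slice_embed I (z * w)"
    by (simp add: \<open>I * I = -1\<close> slice_embed_def of_real_def algebra_simps)
  finally show ?thesis ..
qed

lemma slice_embed_power:
  assumes "I \<in> imag_units"
  shows "slice_embed I (z ^ m) = slice_embed I z ^ m"
  by (induction m) (simp_all add: slice_embed_mult[OF assms])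

lemma continuous_on_slice_embed: "continuous_on S (slice_embed I)"
proof -
  have "linear (slice_embed I)"
    by (rule linearI) (simp_all add: slice_embed_add slice_embed_scaleR)
  then show ?thesis
    by (rule linear_continuous_on_compose[OF continuous_on_id])
qed

locale orthogonal_units =
  fixes i j :: quat
  assumes i_unit: "i \<in> imag_units" and j_unit: "j \<in> imag_units"
    and anticommute: "i * j = - (j * i)"
begin

lemmas split_fst_snd_eq = split_fst_snd[OF i_unit j_unit anticommute]

lemma split_reassemble: "slice_embed i (split_fst i j q) + slice_embed i (split_snd i j q) * j = q"
proof -
  obtain z w where q: "q = slice_embed i z + slice_embed i w * j"
    using splitting_ex1[OF i_unit j_unit anticommute, of q] by blast
  show ?thesis
    unfolding q split_fst_snd_eq ..
qed

lemma split_zero: "split_fst i j 0 = 0" "split_snd i j 0 = 0"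
  using split_fst_snd_eq[of 0 0] by simp_all

lemma split_add:
  "split_fst i j (p + q) = split_fst i j p + split_fst i j q"
  "split_snd i j (p + q) = split_snd i j p + split_snd i j q"
proof -
  have "p + q = slice_embed i (split_fst i j p + split_fst i j q)
      + slice_embed i (split_snd i j p + split_snd i j q) * j"
    by (subst (1) split_reassemble[of p, symmetric], subst (1) split_reassemble[of q, symmetric])
      (simp add: slice_embed_add algebra_simps)
  then show "split_fst i j (p + q) = split_fst i j p + split_fst i j q"
    "split_snd i j (p + q) = split_snd i j p + split_snd i j q"
    by (metis split_fst_snd_eq)+
qed

lemma split_slice_mult:
  "split_fst i j (slice_embed i u * q) = u * split_fst i j q"
  "split_snd i j (slice_embed i u * q) = u * split_snd i j q"
proof -
  have "slice_embed i u * q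
      = slice_embed i (u * split_fst i j q) + slice_embed i (u * split_snd i j q) * j"
    by (subst split_reassemble[of q, symmetric])
      (simp add: slice_embed_mult[OF i_unit] algebra_simps)
  then show "split_fst i j (slice_embed i u * q) = u * split_fst i j q"
    "split_snd i j (slice_embed i u * q) = u * split_snd i j q"
    by (metis split_fst_snd_eq)+
qed

lemma split_scaleR:
  "split_fst i j (r *\<^sub>R q) = r *\<^sub>R split_fst i j q"
  "split_snd i j (r *\<^sub>R q) = r *\<^sub>R split_snd i j q"
  using split_slice_mult[of "of_real r" q]
  by (simp_all add: slice_embed_def scaleR_conv_of_real)

lemma split_sum:
  "split_fst i j (sum F A) = (\<Sum>x\<in>A. split_fst i j (F x))"
  "split_snd i j (sum F A) = (\<Sum>x\<in>A. split_snd i j (F x))"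
  by (induction A rule: infinite_finite_induct) (simp_all add: split_zero split_add)

lemma split_polynomial:
  "split_fst i j (\<Sum>m\<le>n. slice_embed i v ^ m * a m)
     = poly (\<Sum>m\<le>n. monom (split_fst i j (a m)) m) v"
  "split_snd i j (\<Sum>m\<le>n. slice_embed i v ^ m * a m)
     = poly (\<Sum>m\<le>n. monom (split_snd i j (a m)) m) v"
  by (simp_all add: split_sum split_slice_mult slice_embed_power[OF i_unit, symmetric]
      poly_sum poly_monom mult.commute)

section \<open>Real-linear functionals in complex coordinates\<close>

text \<open>The coefficient vector keeps the indices and the signs of the homogeneous coordinates of the
  twistor transform: this is the part of the equation of a hyperplane that is real-linear in
  the value \<open>z + w j\<close>.\<close>

definition coord_functional :: "complex ^ 6 \<Rightarrow> quat \<Rightarrow> complex" where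
  "coord_functional c q =
     c$2 * split_snd i j q - c$3 * split_fst i j q
     + c$4 * cnj (split_fst i j q) + c$5 * cnj (split_snd i j q)"

lemma linear_coord_functional: "linear (coord_functional c)"
  by (rule linearI)
    (simp_all add: coord_functional_def split_add split_scaleR algebra_simps)

end

text \<open>A real-linear map of the complex plane is the sum of a complex-linear and a
  complex-antilinear one, because \<open>Re z\<close> and \<open>Im z\<close> are complex combinations of \<open>z\<close> and its
  conjugate.\<close>

lemma real_linear_complex_representation:
  fixes L :: "complex \<Rightarrow> complex"
  assumes "linear L"
  obtains p q where "\<And>z. L z = p * z + q * cnj z"
proof
  fix z
  have "L z = L (Re z *\<^sub>R 1 + Im z *\<^sub>R \<i>)"
    by (rule arg_cong[of _ _ L]) (simp add: complex_eq_iff)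
  also have "\<dots> = of_real (Re z) * L 1 + of_real (Im z) * L \<i>"
    by (simp only: linear_add[OF assms] linear_scale[OF assms]) (simp only: scaleR_conv_of_real)
  also have "\<dots> = (L 1 - \<i> * L \<i>) / 2 * z + (L 1 + \<i> * L \<i>) / 2 * cnj z"
    by (simp add: complex_eq_iff field_simps)
  finally show "L z = (L 1 - \<i> * L \<i>) / 2 * z + (L 1 + \<i> * L \<i>) / 2 * cnj z" .
qed

text \<open>The functions \<open>z\<close> and \<open>cnj z\<close> are linearly independent: compare the values at \<open>1\<close> and \<open>\<i>\<close>.\<close>

lemma complex_conjugate_independent:
  assumes "\<And>z. p * z + q * cnj z = 0"
  shows "p = 0" "q = 0"
proof -
  have "p + q = 0"
    using assms[of 1] by simp
  moreover have "\<i> * (p - q) = 0"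
    using assms[of \<i>] by (simp add: algebra_simps)
  ultimately show "p = 0" "q = 0"
    by (simp_all add: add_eq_0_iff)
qed

context orthogonal_units
begin

text \<open>Each of the two complex coordinates of a quaternion contributes a complex-linear and an
  antilinear term. The values \<open>r\<close> and \<open>s\<close> are free so that the same vector can serve as the
  equation of a hyperplane: there \<open>r = 0\<close> removes the quadratic term and \<open>s\<close> cancels the
  contribution of the constant coefficient.\<close>

lemma coord_functional_representation:
  fixes \<Lambda> :: "quat \<Rightarrow> complex"
  assumes lin: "linear \<Lambda>"
  obtains c where "\<Lambda> = coord_functional c" "c$1 = r" "c$6 = s"
proof -
  have "linear (\<lambda>z. \<Lambda> (slice_embed i z))"
    by (rule linearI) (simp_all add: slice_embed_add slice_embed_scaleR linear_add[OF lin]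
        linear_scale[OF lin])
  then obtain p q where pq: "\<And>z. \<Lambda> (slice_embed i z) = p * z + q * cnj z"
    by (rule real_linear_complex_representation) blast
  have "linear (\<lambda>w. \<Lambda> (slice_embed i w * j))"
    by (rule linearI) (simp_all add: slice_embed_add slice_embed_scaleR distrib_right
        linear_add[OF lin] linear_scale[OF lin])
  then obtain p' q' where pq': "\<And>w. \<Lambda> (slice_embed i w * j) = p' * w + q' * cnj w"
    by (rule real_linear_complex_representation) blast
  have "\<Lambda> x = coord_functional (vector [r, p', - p, q, q', s]) x" for x
    by (subst split_reassemble[of x, symmetric])
      (simp add: linear_add[OF lin] pq pq' coord_functional_def)
  then show ?thesis
    by (intro that[of "vector [r, p', - p, q, q', s]"] ext) simp_all
qed

lemma coord_functional_eq_0D: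
  assumes "coord_functional c = (\<lambda>_. 0)"
  shows "c$2 = 0" "c$3 = 0" "c$4 = 0" "c$5 = 0"
proof -
  have "coord_functional c (slice_embed i z + slice_embed i w * j) = 0" for z w
    by (simp add: assms)
  then have vanish: "c$2 * w - c$3 * z + c$4 * cnj z + c$5 * cnj w = 0" for z w
    by (simp add: coord_functional_def split_fst_snd_eq)
  have A: "- c$3 * z + c$4 * cnj z = 0" and B: "c$2 * z + c$5 * cnj z = 0" for z
    using vanish[of 0 z] vanish[of z 0] by simp_all
  then show "c$2 = 0" "c$3 = 0" "c$4 = 0" "c$5 = 0"
    using complex_conjugate_independent[OF A] complex_conjugate_independent[OF B] by simp_all
qed

end

section \<open>Planarity as a polynomial relation\<close>

lemma UNIV_6: "UNIV = {1, 2, 3, 4, 5, 6 :: 6}"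
proof -
  have "x = 1 \<or> x = 2 \<or> x = 3 \<or> x = 4 \<or> x = 5 \<or> x = 6" for x :: 6
  proof (induct x)
    case (of_int z)
    then have "z = 0 \<or> z = 1 \<or> z = 2 \<or> z = 3 \<or> z = 4 \<or> z = 5"
      by simp arith
    then show ?case by auto
  qed
  then show ?thesis by auto
qed

lemma sum_6: "sum F (UNIV :: 6 set) = F 1 + F 2 + F 3 + F 4 + F 5 + F 6"
  unfolding UNIV_6 by (simp add: ac_simps)

text \<open>A linear equation for homogeneous coordinates does not depend on the representative.\<close>

lemma proj_point_mem_hyperplane_section_iff:
  assumes "proj_point \<zeta> \<in> Gr2"
  shows "proj_point \<zeta> \<in> hyperplane_section c \<longleftrightarrow> \<zeta> \<noteq> 0 \<and> (\<Sum>k\<in>UNIV. c$k * \<zeta>$k) = 0"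
proof
  assume "proj_point \<zeta> \<in> hyperplane_section c"
  then obtain \<xi> where \<xi>: "proj_point \<zeta> = proj_point \<xi>" "\<xi> \<noteq> 0" "(\<Sum>k\<in>UNIV. c$k * \<xi>$k) = 0"
    by (auto simp: hyperplane_section_def)
  have "\<zeta> \<in> vec.span {\<xi>}" "\<xi> \<in> vec.span {\<zeta>}"
    by (metis \<xi>(1) insertI1 proj_point_def vec.span_base)+
  then obtain t s where ts: "\<zeta> = t *s \<xi>" "\<xi> = s *s \<zeta>"
    unfolding vec.span_singleton by blast
  have "(\<Sum>k\<in>UNIV. c$k * \<zeta>$k) = t * (\<Sum>k\<in>UNIV. c$k * \<xi>$k)"
    unfolding sum_distrib_left by (rule sum.cong) (simp_all add: ts(1))
  then show "\<zeta> \<noteq> 0 \<and> (\<Sum>k\<in>UNIV. c$k * \<zeta>$k) = 0"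
    using \<xi>(2,3) ts(2) by auto
qed (use assms in \<open>auto simp: hyperplane_section_def\<close>)

lemma twistor_transform_mem_hyperplane_section_iff:
  fixes f :: "quat \<Rightarrow> quat"
  assumes "\<And>v. split_fst i j (f (slice_embed i v)) = poly P v"
    and "\<And>v. split_snd i j (f (slice_embed i v)) = poly Q v"
  shows "twistor_transform i j f v \<in> hyperplane_section c \<longleftrightarrow>
    poly (smult (c$1) (P * map_poly cnj P + Q * map_poly cnj Q) + smult (c$2) Q - smult (c$3) P
      + smult (c$4) (map_poly cnj P) + smult (c$5) (map_poly cnj Q) + [:c$6:]) v = 0"
proof -
  let ?\<zeta> = "vector [poly P v * cnj (poly P (cnj v)) + poly Q v * cnj (poly Q (cnj v)), poly Q v,
    - poly P v, cnj (poly P (cnj v)), cnj (poly Q (cnj v)), 1] :: complex ^ 6"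
  have t: "twistor_transform i j f v = proj_point ?\<zeta>"
    by (simp add: twistor_transform_def assms Let_def)
  have "?\<zeta> \<noteq> 0"
    by (metis vector_6(6) zero_index zero_neq_one)
  moreover have "proj_point ?\<zeta> \<in> Gr2"
    using twistor_transform_in_Gr2[of i j f v] by (simp only: t)
  ultimately have "twistor_transform i j f v \<in> hyperplane_section c
      \<longleftrightarrow> (\<Sum>k\<in>UNIV. c$k * ?\<zeta>$k) = 0"
    by (simp only: t proj_point_mem_hyperplane_section_iff simp_thms)
  then show ?thesis
    by (simp add: sum_6 algebra_simps)
qed

lemma poly_eq_0_iff_vanishes_on_infinite:
  fixes p :: "'a::{comm_ring_1,ring_no_zero_divisors} poly"
  assumes "infinite V"
  shows "p = 0 \<longleftrightarrow> (\<forall>v\<in>V. poly p v = 0)"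
proof
  assume "\<forall>v\<in>V. poly p v = 0"
  then have "V \<subseteq> {v. poly p v = 0}" by blast
  then show "p = 0"
    using poly_roots_finite[of p] assms finite_subset by blast
qed simp

lemma planar_twistor_transform_iff:
  fixes f :: "quat \<Rightarrow> quat"
  assumes "\<And>v. split_fst i j (f (slice_embed i v)) = poly P v"
    and "\<And>v. split_snd i j (f (slice_embed i v)) = poly Q v"
    and "infinite V"
  shows "planar V (twistor_transform i j f) \<longleftrightarrow> (\<exists>c :: complex ^ 6. c \<noteq> 0 \<and>
    smult (c$1) (P * map_poly cnj P + Q * map_poly cnj Q) + smult (c$2) Q - smult (c$3) P
      + smult (c$4) (map_poly cnj P) + smult (c$5) (map_poly cnj Q) + [:c$6:] = 0)"
  unfolding planar_def image_subset_iff
    twistor_transform_mem_hyperplane_section_iff[OF assms(1,2)]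
    poly_eq_0_iff_vanishes_on_infinite[OF assms(3)] ..

text \<open>At a real point of \<open>\<Omega>\<close> a small step in the direction \<open>I\<close> stays in \<open>\<Omega>\<close>, so the half slice is
  nonempty; being open, it is infinite, as the identity theorem for polynomials requires.\<close>

lemma infinite_upper_half_slice:
  assumes "open \<Omega>" "\<Omega> \<inter> \<real> \<noteq> {}"
  shows "infinite (upper_half_slice I \<Omega>)"
proof -
  let ?W = "slice_embed I -` \<Omega>"
  have W: "open ?W"
    using continuous_on_slice_embed[of UNIV I] assms(1) by (rule open_vimage[rotated])
  have "upper_half_slice I \<Omega> = ?W \<inter> {z. Im z > 0}"
    by (auto simp: upper_half_slice_def)
  then have "open (upper_half_slice I \<Omega>)"
    using W by (simp add: open_Int open_halfspace_Im_gt)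
  moreover have "upper_half_slice I \<Omega> \<noteq> {}"
  proof -
    obtain x :: real where "of_real x \<in> \<Omega>"
      using assms(2) by (auto elim: Reals_cases)
    then have "complex_of_real x \<in> ?W"
      by (simp add: slice_embed_def)
    with W obtain e where e: "e > 0" "ball (complex_of_real x) e \<subseteq> ?W"
      by (meson openE)
    have "Complex x (e/2) \<in> ball (complex_of_real x) e"
      using e(1) by (simp add: dist_norm cmod_def)
    then show ?thesis
      using e by (force simp: upper_half_slice_def)
  qed
  ultimately show ?thesis
    using finite_imp_not_open by blast
qed

section \<open>Comparison of coefficients\<close>

lemma coeff_mult_degree_bounds:
  fixes p q :: "'a::comm_semiring_0 poly"
  assumes "degree p \<le> d" "degree q \<le> e"
  shows "coeff (p * q) (d + e) = coeff p d * coeff q e"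
proof -
  have "coeff (p * q) (d + e) = (\<Sum>k\<le>d + e. coeff p k * coeff q (d + e - k))"
    by (rule coeff_mult)
  also have "\<dots> = (\<Sum>k\<in>{d}. coeff p k * coeff q (d + e - k))"
  proof (rule sum.mono_neutral_right)
    show "\<forall>k\<in>{..d + e} - {d}. coeff p k * coeff q (d + e - k) = 0"
    proof
      fix k assume "k \<in> {..d + e} - {d}"
      then have "k > degree p \<or> d + e - k > degree q"
        using assms by auto
      then show "coeff p k * coeff q (d + e - k) = 0"
        by (auto simp: coeff_eq_0)
    qed
  qed auto
  finally show ?thesis by simp
qed

text \<open>The coefficient of degree twice the maximal degree cannot cancel, being \<open>c\<^sub>1\<close> times the
  positive number \<open>|p\<^sub>d|\<^sup>2 + |q\<^sub>d|\<^sup>2\<close>.\<close>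

lemma quadratic_relation_imp_linear:
  assumes rel: "smult c1 (P * map_poly cnj P + Q * map_poly cnj Q) + R = 0"
    and R: "degree R \<le> max (degree P) (degree Q)"
    and pos: "max (degree P) (degree Q) > 0"
  shows "c1 = 0"
proof -
  define d where "d = max (degree P) (degree Q)"
  have deg: "degree P \<le> d" "degree Q \<le> d" "degree (map_poly cnj P) \<le> d"
    "degree (map_poly cnj Q) \<le> d"
    using map_poly_degree_leq[of cnj P] map_poly_degree_leq[of cnj Q] by (auto simp: d_def)
  have "coeff R (d + d) = 0"
    using R pos by (intro coeff_eq_0) (simp add: d_def)
  then have "0 = c1 * (coeff P d * cnj (coeff P d) + coeff Q d * cnj (coeff Q d))"
    using arg_cong[OF rel, of "\<lambda>p. coeff p (d + d)"]
    by (simp add: coeff_mult_degree_bounds deg coeff_map_poly)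
  also have "\<dots> = c1 * of_real ((cmod (coeff P d))\<^sup>2 + (cmod (coeff Q d))\<^sup>2)"
    by (simp only: of_real_add complex_norm_square)
  finally have "c1 = 0 \<or> (cmod (coeff P d))\<^sup>2 + (cmod (coeff Q d))\<^sup>2 = 0"
    by (metis mult_eq_0_iff of_real_eq_0_iff)
  moreover have "coeff P d \<noteq> 0 \<or> coeff Q d \<noteq> 0"
    using pos unfolding d_def by (metis degree_0 leading_coeff_0_iff max_def not_less_zero)
  ultimately show ?thesis
    by (auto simp: sum_power2_eq_zero_iff)
qed

context orthogonal_units
begin

text \<open>Once the quadratic term is gone, the polynomial relation has the coefficients
  \<open>coord_functional c (a m)\<close>, with \<open>c\<^sub>6\<close> added in degree zero. Hence a relation and a functional
  that kills all \<open>a m\<close> with \<open>m > 0\<close> determine each other, and a relation with zero functional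
  would also have \<open>c\<^sub>6 = 0\<close>.\<close>

lemma planar_polynomial_iff:
  fixes a :: "nat \<Rightarrow> quat"
  assumes V: "infinite V" and nonconst: "\<exists>m\<in>{1..n}. a m \<noteq> 0"
  shows "planar V (twistor_transform i j (\<lambda>q. \<Sum>m\<le>n. q ^ m * a m)) \<longleftrightarrow>
    (\<exists>\<Lambda> :: quat \<Rightarrow> complex. linear \<Lambda> \<and> \<Lambda> \<noteq> (\<lambda>_. 0) \<and> (\<forall>m\<in>{1..n}. \<Lambda> (a m) = 0))"
    (is "?planar \<longleftrightarrow> ?functional")
proof -
  define P where "P = (\<Sum>m\<le>n. monom (split_fst i j (a m)) m)"
  define Q where "Q = (\<Sum>m\<le>n. monom (split_snd i j (a m)) m)"
  define lin where "lin c = smult (c$2) Q - smult (c$3) P + smult (c$4) (map_poly cnj P)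
    + smult (c$5) (map_poly cnj Q) + [:c$6:]" for c :: "complex ^ 6"
  have coeffs: "coeff P m = (if m \<le> n then split_fst i j (a m) else 0)"
    "coeff Q m = (if m \<le> n then split_snd i j (a m) else 0)" for m
    by (simp_all add: P_def Q_def coeff_sum sum.delta)
  have coeff_lin: "coeff (lin c) m
      = (if m \<le> n then coord_functional c (a m) else 0) + (if m = 0 then c$6 else 0)" for c m
    by (simp add: lin_def coord_functional_def coeff_map_poly coeffs coeff_pCons split: nat.split)
  have planar_iff: "?planar \<longleftrightarrow>
      (\<exists>c. c \<noteq> 0 \<and> smult (c$1) (P * map_poly cnj P + Q * map_poly cnj Q) + lin c = 0)"
    unfolding lin_def
    by (subst planar_twistor_transform_iff[OF _ _ V, of _ _ _ P Q])
      (simp_all add: split_polynomial P_def Q_def algebra_simps)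
  show ?thesis
  proof
    assume ?planar
    then obtain c where c: "c \<noteq> 0"
        "smult (c$1) (P * map_poly cnj P + Q * map_poly cnj Q) + lin c = 0"
      unfolding planar_iff by blast
    have "max (degree P) (degree Q) > 0"
    proof -
      obtain m where m: "m \<in> {1..n}" "a m \<noteq> 0"
        using nonconst by blast
      have "coeff P m \<noteq> 0 \<or> coeff Q m \<noteq> 0"
        using m split_reassemble[of "a m"] by (auto simp: coeffs)
      then have "m \<le> degree P \<or> m \<le> degree Q"
        by (auto intro: le_degree)
      then show ?thesis using m(1) by auto
    qed
    moreover have "degree (lin c) \<le> max (degree P) (degree Q)"
      unfolding lin_def
      by (intro degree_add_le degree_diff_le order.trans[OF degree_smult_le])
        (auto intro: order.trans[OF map_poly_degree_leq])
    ultimately have c1: "c$1 = 0"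
      using quadratic_relation_imp_linear[OF c(2)] by blast
    then have zero: "coeff (lin c) m = 0" for m
      using c(2) by simp
    have "coord_functional c (a m) = 0" if "m \<in> {1..n}" for m
      using zero[of m] that by (simp add: coeff_lin)
    moreover have "coord_functional c \<noteq> (\<lambda>_. 0)"
    proof
      assume 0: "coord_functional c = (\<lambda>_. 0)"
      then have "c$6 = 0"
        using zero[of 0] by (simp add: coeff_lin)
      with c1 coord_functional_eq_0D[OF 0] have "c$k = 0" for k
        using UNIV_6 by (metis UNIV_I empty_iff insert_iff)
      with c(1) show False by (simp add: vec_eq_iff)
    qed
    ultimately show ?functional
      using linear_coord_functional by blast
  next
    assume ?functional
    then obtain \<Lambda> :: "quat \<Rightarrow> complex"
      where \<Lambda>: "linear \<Lambda>" "\<Lambda> \<noteq> (\<lambda>_. 0)" "\<forall>m\<in>{1..n}. \<Lambda> (a m) = 0" by blast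
    obtain c where c: "\<Lambda> = coord_functional c" "c$1 = 0" "c$6 = - \<Lambda> (a 0)"
      using coord_functional_representation[OF \<Lambda>(1)] by blast
    have nonzero: "c \<noteq> 0"
      using \<Lambda>(2) c(1) by (auto simp: coord_functional_def)
    have lin0: "lin c = 0"
      using \<Lambda>(3) c(1,3) by (intro poly_eqI) (auto simp: coeff_lin)
    show ?planar
      unfolding planar_iff by (rule exI[of _ c]) (simp add: nonzero c(2) lin0)
  qed
qed

end

section \<open>Functionals, proper subspaces and dimension\<close>

text \<open>The real functional given by the inner product with a normal vector of the subspace is
  already a suitable complex-valued one.\<close>

lemma ex_functional_iff_proper_subspace:
  fixes S :: "'a::euclidean_space set"
  shows "(\<exists>\<Lambda> :: 'a \<Rightarrow> complex. linear \<Lambda> \<and> \<Lambda> \<noteq> (\<lambda>_. 0) \<and> (\<forall>x\<in>S. \<Lambda> x = 0))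
    \<longleftrightarrow> (\<exists>T. subspace T \<and> T \<noteq> UNIV \<and> S \<subseteq> T)"
proof
  assume "\<exists>\<Lambda> :: 'a \<Rightarrow> complex. linear \<Lambda> \<and> \<Lambda> \<noteq> (\<lambda>_. 0) \<and> (\<forall>x\<in>S. \<Lambda> x = 0)"
  then obtain \<Lambda> :: "'a \<Rightarrow> complex"
    where \<Lambda>: "linear \<Lambda>" "\<Lambda> \<noteq> (\<lambda>_. 0)" "\<forall>x\<in>S. \<Lambda> x = 0" by blast
  have "subspace {x. \<Lambda> x = 0}"
    using \<Lambda>(1) by (rule linear_subspace_kernel)
  then show "\<exists>T. subspace T \<and> T \<noteq> UNIV \<and> S \<subseteq> T"
    using \<Lambda>(2,3) by (intro exI[of _ "{x. \<Lambda> x = 0}"]) auto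
next
  assume "\<exists>T. subspace T \<and> T \<noteq> UNIV \<and> S \<subseteq> T"
  then obtain T where T: "subspace T" "T \<noteq> UNIV" "S \<subseteq> T" by blast
  then have "span T \<subset> span UNIV"
    by (simp add: span_eq_iff[THEN iffD2] psubset_eq)
  then obtain x where x: "x \<noteq> 0" "\<And>y. y \<in> span T \<Longrightarrow> orthogonal x y"
    using orthogonal_to_subspace_exists_gen by blast
  let ?\<Lambda> = "\<lambda>y. complex_of_real (inner x y)"
  have "linear ?\<Lambda>"
    by (rule linearI) (simp_all add: inner_add_right scaleR_conv_of_real)
  moreover have "?\<Lambda> \<noteq> (\<lambda>_. 0)"
    using x(1) by (metis inner_eq_zero_iff of_real_eq_0_iff)
  moreover have "\<forall>y\<in>S. ?\<Lambda> y = 0"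
    using x(2) T(3) by (auto simp: orthogonal_def span_base)
  ultimately show "\<exists>\<Lambda> :: 'a \<Rightarrow> complex. linear \<Lambda> \<and> \<Lambda> \<noteq> (\<lambda>_. 0) \<and> (\<forall>x\<in>S. \<Lambda> x = 0)"
    by blast
qed

lemma proper_subspace_iff_dim:
  fixes S :: "'a::euclidean_space set"
  shows "(\<exists>T. subspace T \<and> T \<noteq> UNIV \<and> S \<subseteq> T) \<longleftrightarrow> dim S < DIM('a)"
proof -
  have "(\<exists>T. subspace T \<and> T \<noteq> UNIV \<and> S \<subseteq> T) \<longleftrightarrow> span S \<noteq> UNIV"
    by (metis span_minimal span_superset subspace_span top.extremum_uniqueI)
  also have "\<dots> \<longleftrightarrow> dim S \<noteq> DIM('a)"
    by (simp only: dim_eq_full)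
  also have "\<dots> \<longleftrightarrow> dim S < DIM('a)"
    using dim_subset_UNIV[of S] by auto
  finally show ?thesis .
qed

lemma nonconstant_polynomial_coeff:
  fixes a :: "nat \<Rightarrow> 'a::semiring_1"
  assumes "\<not> (\<lambda>q. \<Sum>m\<le>n. q ^ m * a m) constant_on S"
  shows "\<exists>m\<in>{1..n}. a m \<noteq> 0"
proof (rule ccontr)
  assume "\<not> (\<exists>m\<in>{1..n}. a m \<noteq> 0)"
  then have "(\<Sum>m\<le>n. q ^ m * a m) = (\<Sum>m\<in>{0}. q ^ m * a m)" for q
    by (intro sum.mono_neutral_right) auto
  with assms show False
    by (simp add: constant_on_def)
qed

theorem theorem4p3:
  fixes i j :: quat and \<Omega> :: "quat set" and n :: nat and a :: "nat \<Rightarrow> quat"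
    and f :: "quat \<Rightarrow> quat"
  assumes "f = (\<lambda>q. \<Sum>m\<le>n. q ^ m * a m)"
    and "i \<in> imag_units" and "j \<in> imag_units" and "i * j = - (j * i)"
    and "symmetric_slice_domain \<Omega>"
    and "\<not> f constant_on \<Omega>"
  shows "(planar (upper_half_slice i \<Omega>) (twistor_transform i j f)
            \<longleftrightarrow> (\<exists>\<Lambda> :: quat \<Rightarrow> complex. linear \<Lambda> \<and> \<Lambda> \<noteq> (\<lambda>_. 0) \<and> (\<forall>m\<in>{1..n}. \<Lambda> (a m) = 0)))
       \<and> ((\<exists>\<Lambda> :: quat \<Rightarrow> complex. linear \<Lambda> \<and> \<Lambda> \<noteq> (\<lambda>_. 0) \<and> (\<forall>m\<in>{1..n}. \<Lambda> (a m) = 0))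
            \<longleftrightarrow> (\<exists>T. subspace T \<and> T \<noteq> UNIV \<and> a ` {1..n} \<subseteq> T))
       \<and> ((\<exists>T. subspace T \<and> T \<noteq> UNIV \<and> a ` {1..n} \<subseteq> T)
            \<longleftrightarrow> dim (span (a ` {1..n})) \<le> 3)"
proof (intro conjI)
  interpret orthogonal_units i j
    using assms(2-4) by unfold_locales
  have "infinite (upper_half_slice i \<Omega>)"
    using assms(5) by (intro infinite_upper_half_slice) (simp_all add: symmetric_slice_domain_def)
  moreover have "\<exists>m\<in>{1..n}. a m \<noteq> 0"
    using assms(1,6) nonconstant_polynomial_coeff by blast
  ultimately show "planar (upper_half_slice i \<Omega>) (twistor_transform i j f)
      \<longleftrightarrow> (\<exists>\<Lambda> :: quat \<Rightarrow> complex. linear \<Lambda> \<and> \<Lambda> \<noteq> (\<lambda>_. 0) \<and> (\<forall>m\<in>{1..n}. \<Lambda> (a m) = 0))"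
    unfolding assms(1) by (rule planar_polynomial_iff)
  show "(\<exists>\<Lambda> :: quat \<Rightarrow> complex. linear \<Lambda> \<and> \<Lambda> \<noteq> (\<lambda>_. 0) \<and> (\<forall>m\<in>{1..n}. \<Lambda> (a m) = 0))
      \<longleftrightarrow> (\<exists>T. subspace T \<and> T \<noteq> UNIV \<and> a ` {1..n} \<subseteq> T)"
    using ex_functional_iff_proper_subspace[of "a ` {1..n}"] by simp
  show "(\<exists>T. subspace T \<and> T \<noteq> UNIV \<and> a ` {1..n} \<subseteq> T) \<longleftrightarrow> dim (span (a ` {1..n})) \<le> 3"
    unfolding proper_subspace_iff_dim dim_span DIM_quat by linarith
qed

end
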